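(* For every integer $n\geqslant 5$, the graph $A_n$ is $d$-balanced, i.e. $\gamma_{bd}(A_n)=0$.
   Context: For a simple undirected finite graph $G$ and $v\in V(G)$, the closed neighborhood is $N_G[v]=\{u\in V(G): uv\in E(G)\}\cup\{v\}$. A function $f\colon V(G)\to\{-1,0,1\}$ is a balanced domination function (BDF) on $G$ if $\sum_{u\in N_G[v]} f(u)=0$ for every $v\in V(G)$. Its weight is $\omega_f=\sum_{v\in V(G)} f(v)$. The balanced domination number $\gamma_{bd}(G)$ is the maximum of $\omega_f$ over all BDFs $f$ on $G$. The graph $G$ is called $d$-balanced if $\gamma_{bd}(G)=0$. For $n\geqslant 5$, the convex polytope graph (antiprism) $A_n$ is the simple undirected graph with vertex set $V(A_n)=\{u_i,v_i,w_i \mid 0\leqslant i\leqslant n-1\}$ ($3n$ distinct vertices) and edge set $E(A_n)=\{u_iu_{i+1},\ v_iv_{i+1},\ w_iw_{i+1},\ u_iv_i,\ v_iw_i,\ u_{i+1}v_i,\ v_{i+1}w_i \mid 0\leqslant i\leqslant n-1\}$, where indices are taken modulo $n$. *)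

theory Defs
  imports "Graph_Theory.Graph_Theory"
begin

text \<open>
  A finite simple undirected graph is a \<^locale>\<open>pair_graph\<close>: a finite vertex set with a
  symmetric, irreflexive set of arcs, an undirected edge being a pair of opposite arcs.
\<close>

definition closed_neighborhood :: "'a pair_pre_digraph \<Rightarrow> 'a \<Rightarrow> 'a set" where
  "closed_neighborhood G v = insert v {u \<in> pverts G. (u, v) \<in> parcs G}"

text \<open>Values of a function outside the vertex set are irrelevant.\<close>

definition balanced_dom_fun :: "'a pair_pre_digraph \<Rightarrow> ('a \<Rightarrow> int) \<Rightarrow> bool" where
  "balanced_dom_fun G f \<longleftrightarrow>
     f \<in> pverts G \<rightarrow> {-1, 0, 1} \<and>
     (\<forall>v \<in> pverts G. (\<Sum>u \<in> closed_neighborhood G v. f u) = 0)"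

definition weight :: "'a pair_pre_digraph \<Rightarrow> ('a \<Rightarrow> int) \<Rightarrow> int" where
  "weight G f = (\<Sum>v \<in> pverts G. f v)"

definition balanced_dom_number :: "'a pair_pre_digraph \<Rightarrow> int" where
  "balanced_dom_number G = Max {weight G f | f. balanced_dom_fun G f}"

definition d_balanced :: "'a pair_pre_digraph \<Rightarrow> bool" where
  "d_balanced G \<longleftrightarrow> balanced_dom_number G = 0"

text \<open>The maximum ranges over a finite nonempty set of weights.\<close>

lemma finite_weights:
  fixes G :: "'a pair_pre_digraph"
  shows "finite {weight G f | f. balanced_dom_fun G f}"
proof (rule finite_subset)
  show "{weight G f | f. balanced_dom_fun G f} \<subseteq> {- int (card (pverts G)) .. int (card (pverts G))}"
  proof clarify
    fix f assume "balanced_dom_fun G f"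
    then have "\<bar>f v\<bar> \<le> 1" if "v \<in> pverts G" for v
      using that by (fastforce simp: balanced_dom_fun_def Pi_iff)
    then have "(\<Sum>v \<in> pverts G. \<bar>f v\<bar>) \<le> int (card (pverts G))"
      using sum_bounded_above[of "pverts G" "\<lambda>v. \<bar>f v\<bar>" 1] by simp
    then have "\<bar>weight G f\<bar> \<le> int (card (pverts G))"
      unfolding weight_def using sum_abs[of f "pverts G"] by linarith
    then show "weight G f \<in> {- int (card (pverts G)) .. int (card (pverts G))}"
      by auto
  qed
qed simp

lemma weights_nonempty:
  fixes G :: "'a pair_pre_digraph"
  shows "{weight G f | f. balanced_dom_fun G f} \<noteq> {}"
proof -
  have "balanced_dom_fun G (\<lambda>_. 0)" by (simp add: balanced_dom_fun_def)
  then show ?thesis by blast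
qed

datatype antiprism_vertex = VertU nat | VertV nat | VertW nat

definition antiprism_edges :: "nat \<Rightarrow> antiprism_vertex rel" where
  "antiprism_edges n = (\<Union>i<n. let j = (i + 1) mod n in
     {(VertU i, VertU j), (VertV i, VertV j), (VertW i, VertW j),
      (VertU i, VertV i), (VertV i, VertW i), (VertU j, VertV i), (VertV j, VertW i)})"

definition antiprism :: "nat \<Rightarrow> antiprism_vertex pair_pre_digraph" where
  "antiprism n =
     \<lparr> pverts = VertU ` {..<n} \<union> VertV ` {..<n} \<union> VertW ` {..<n},
       parcs = antiprism_edges n \<union> (antiprism_edges n)\<inverse> \<rparr>"

lemma pair_graph_antiprism:
  assumes "n \<ge> 5"
  shows "pair_graph (antiprism n)"
proof -
  have ne: "Suc i mod n \<noteq> i" if "i < n" for i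
    using that assms by (cases "Suc i = n") auto
  have lt: "Suc i mod n < n" for i
    using assms by simp
  show ?thesis
  proof unfold_locales
    show "finite (pverts (antiprism n))" by (simp add: antiprism_def)
    show "finite (parcs (antiprism n))"
      by (simp add: antiprism_def antiprism_edges_def Let_def)
    show "symmetric (with_proj (antiprism n))"
      by (auto simp: symmetric_def antiprism_def sym_def)
    fix e assume "e \<in> parcs (antiprism n)"
    then show "fst e \<in> pverts (antiprism n)" "snd e \<in> pverts (antiprism n)" "fst e \<noteq> snd e"
      using lt by (auto dest: ne simp: antiprism_def antiprism_edges_def Let_def)
  qed
qed

end

theory Submission
  imports Defs
begin

text \<open>
  Every BDF has weight zero. Let \<open>U, V, W\<close> be the sums of \<open>f\<close> over the three cycles. Adding the
  neighborhood conditions over each cycle gives \<open>3U + 2V = 0\<close>, \<open>2U + 3V + 2W = 0\<close> and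
  \<open>2V + 3W = 0\<close>; the first minus the second plus the third is \<open>U + V + W = 0\<close>.
\<close>

lemma inj_on_Suc_mod: "inj_on (\<lambda>i. Suc i mod n) {..<n}"
proof (rule inj_onI)
  fix i j assume "i \<in> {..<n}" "j \<in> {..<n}" "Suc i mod n = Suc j mod n"
  then show "i = j"
    by (cases "Suc i = n"; cases "Suc j = n") auto
qed

lemma bij_betw_Suc_mod: "bij_betw (\<lambda>i. Suc i mod n) {..<n} {..<n}"
  unfolding bij_betw_def
  by (metis (no_types, lifting) endo_inj_surj finite_lessThan image_subsetI inj_on_Suc_mod
      lessThan_iff mod_less_divisor gr_zeroI not_less_zero)

text \<open>The cyclic shift permutes the indices, so a sum over a whole cycle is shift invariant.
  This collapses all shifted terms of the neighborhood conditions into three cycle sums.\<close>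

lemma sum_Suc_mod: "(\<Sum>i<n. g (Suc i mod n)) = (\<Sum>i<n. g i)"
  by (rule sum.reindex_bij_betw[OF bij_betw_Suc_mod])

lemma Suc_mod_eq_iff:
  assumes "i < n" "j < n"
  shows "Suc i mod n = Suc j mod n \<longleftrightarrow> i = j"
  using inj_on_Suc_mod[of n] assms by (auto dest: inj_onD)

text \<open>The center has index \<open>i + 1\<close> so that no cyclic predecessor is needed.\<close>

lemma closed_neighborhood_antiprism:
  assumes "i < n" and j: "j = Suc i mod n" and k: "k = Suc j mod n"
  shows
    "closed_neighborhood (antiprism n) (VertU j) =
       {VertU i, VertU j, VertU k, VertV i, VertV j}"
    "closed_neighborhood (antiprism n) (VertV j) =
       {VertV i, VertV j, VertV k, VertU j, VertU k, VertW i, VertW j}"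
    "closed_neighborhood (antiprism n) (VertW j) =
       {VertW i, VertW j, VertW k, VertV j, VertV k}"
proof -
  have jk: "j < n" "k < n" using assms by auto
  \<comment> \<open>Edges generated at index \<open>l\<close> reach forward to
    \<open>Suc l mod n\<close>. By injectivity of the shift, \<open>i\<close> is the only index
    whose edges reach forward to \<open>j\<close>.\<close>
  have pred: "j = Suc l mod n \<longleftrightarrow> l = i" if "l < n" for l
    using Suc_mod_eq_iff[of l n i] that assms by auto
  note defs = closed_neighborhood_def antiprism_def antiprism_edges_def Let_def
  show
    "closed_neighborhood (antiprism n) (VertU j) =
       {VertU i, VertU j, VertU k, VertV i, VertV j}"
    "closed_neighborhood (antiprism n) (VertV j) =
       {VertV i, VertV j, VertV k, VertU j, VertU k, VertW i, VertW j}"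
    "closed_neighborhood (antiprism n) (VertW j) =
       {VertW i, VertW j, VertW k, VertV j, VertV k}"
    \<comment> \<open>The witness \<open>j\<close> generates the edges from the center to index
      \<open>k\<close> and those between different cycles at index \<open>j\<close>.\<close>
    using \<open>i < n\<close> jk by (auto simp: defs pred k[symmetric] j[symmetric] intro: bexI[of _ j])
qed

text \<open>Guarantees that the listed neighbors are pairwise different, so a sum over the
  neighborhood has one term per listed vertex. For \<open>n = 2\<close> the indices \<open>i\<close>
  and \<open>k\<close> would coincide.\<close>

lemma Suc_mod_distinct:
  assumes "n \<ge> 3" "i < n" "j = Suc i mod n" "k = Suc j mod n"
  shows "i \<noteq> j" "j \<noteq> k" "i \<noteq> k"
  using assms by (cases "Suc i = n"; cases "Suc (Suc i) = n"; simp)+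

lemma weight_antiprism:
  "weight (antiprism n) f =
     (\<Sum>i<n. f (VertU i)) + (\<Sum>i<n. f (VertV i)) + (\<Sum>i<n. f (VertW i))"
proof -
  have "weight (antiprism n) f =
      sum f (VertU ` {..<n}) + sum f (VertV ` {..<n}) + sum f (VertW ` {..<n})"
    unfolding weight_def antiprism_def pair_pre_digraph.simps
    by (subst sum.union_disjoint; (subst sum.union_disjoint)?; auto)
  then show ?thesis
    by (simp add: sum.reindex inj_on_def)
qed

lemma weight_antiprism_eq_0:
  assumes "n \<ge> 3" and f: "balanced_dom_fun (antiprism n) f"
  shows "weight (antiprism n) f = 0"
proof -
  define s where "s i = Suc i mod n" for i
  \<comment> \<open>As \<open>i\<close> runs below \<open>n\<close>, so does \<open>s i\<close>;
    hence these equations cover each center exactly once.\<close>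
  have eqs:
    "f (VertU i) + f (VertU (s i)) + f (VertU (s (s i))) + f (VertV i) + f (VertV (s i)) = 0"
    "f (VertV i) + f (VertV (s i)) + f (VertV (s (s i))) + f (VertU (s i)) + f (VertU (s (s i)))
       + f (VertW i) + f (VertW (s i)) = 0"
    "f (VertW i) + f (VertW (s i)) + f (VertW (s (s i))) + f (VertV (s i)) + f (VertV (s (s i))) = 0"
    if "i < n" for i
  proof -
    have "s i < n" using that by (simp add: s_def)
    then have bal: "(\<Sum>u \<in> closed_neighborhood (antiprism n) x. f u) = 0"
      if "x \<in> {VertU (s i), VertV (s i), VertW (s i)}" for x
      using f that by (auto simp: balanced_dom_fun_def antiprism_def)
    note distinct = Suc_mod_distinct[OF \<open>n \<ge> 3\<close> that s_def s_def]
    note nbh = closed_neighborhood_antiprism[OF that s_def s_def]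
    show
      "f (VertU i) + f (VertU (s i)) + f (VertU (s (s i))) + f (VertV i) + f (VertV (s i)) = 0"
      using bal[of "VertU (s i)"] distinct by (simp add: nbh)
    show
      "f (VertV i) + f (VertV (s i)) + f (VertV (s (s i))) + f (VertU (s i)) + f (VertU (s (s i)))
         + f (VertW i) + f (VertW (s i)) = 0"
      using bal[of "VertV (s i)"] distinct by (simp add: nbh)
    show
      "f (VertW i) + f (VertW (s i)) + f (VertW (s (s i))) + f (VertV (s i)) + f (VertV (s (s i))) = 0"
      using bal[of "VertW (s i)"] distinct by (simp add: nbh)
  qed
  have shift: "(\<Sum>i<n. g (s i)) = (\<Sum>i<n. g i)" "(\<Sum>i<n. g (s (s i))) = (\<Sum>i<n. g i)"
    for g :: "nat \<Rightarrow> int"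
    using sum_Suc_mod[of g n] sum_Suc_mod[of "\<lambda>i. g (Suc i mod n)" n] by (simp_all add: s_def)
  define U V W where
    "U = (\<Sum>i<n. f (VertU i))" and "V = (\<Sum>i<n. f (VertV i))" and "W = (\<Sum>i<n. f (VertW i))"
  note shifts = shift[of "\<lambda>i. f (VertU i)", folded U_def]
    shift[of "\<lambda>i. f (VertV i)", folded V_def] shift[of "\<lambda>i. f (VertW i)", folded W_def]
  \<comment> \<open>Each coefficient counts the members of a closed neighborhood on one cycle: three
    on the center's own cycle and two on each adjacent cycle.\<close>
  have "3 * U + 2 * V = 0"
  proof -
    have "(\<Sum>i<n. f (VertU i) + f (VertU (s i)) + f (VertU (s (s i)))
        + f (VertV i) + f (VertV (s i))) = 0"
      by (simp add: eqs(1))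
    then show ?thesis
      by (simp add: sum.distrib shifts U_def[symmetric] V_def[symmetric] W_def[symmetric])
  qed
  moreover have "2 * U + 3 * V + 2 * W = 0"
  proof -
    have "(\<Sum>i<n. f (VertV i) + f (VertV (s i)) + f (VertV (s (s i)))
        + f (VertU (s i)) + f (VertU (s (s i))) + f (VertW i) + f (VertW (s i))) = 0"
      by (simp add: eqs(2))
    then show ?thesis
      by (simp add: sum.distrib shifts U_def[symmetric] V_def[symmetric] W_def[symmetric])
  qed
  moreover have "2 * V + 3 * W = 0"
  proof -
    have "(\<Sum>i<n. f (VertW i) + f (VertW (s i)) + f (VertW (s (s i)))
        + f (VertV (s i)) + f (VertV (s (s i)))) = 0"
      by (simp add: eqs(3))
    then show ?thesis
      by (simp add: sum.distrib shifts U_def[symmetric] V_def[symmetric] W_def[symmetric])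
  qed
  ultimately show ?thesis
    unfolding weight_antiprism U_def[symmetric] V_def[symmetric] W_def[symmetric] by linarith
qed

theorem theorem1:
  fixes n :: nat
  assumes "n \<ge> 5"
  shows "d_balanced (antiprism n)"
proof -
  have "weight (antiprism n) f = 0" if "balanced_dom_fun (antiprism n) f" for f
    using weight_antiprism_eq_0 that assms by simp
  \<comment> \<open>Nonemptiness, witnessed by the zero function, upgrades inclusion in
    \<open>{0}\<close> to equality, so \<open>Max\<close> is taken over a singleton.\<close>
  then have "{weight (antiprism n) f | f. balanced_dom_fun (antiprism n) f} = {0}"
    using weights_nonempty[of "antiprism n"] by fastforce
  then show ?thesis
    by (simp add: d_balanced_def balanced_dom_number_def)
qed

end
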